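(* Let $n\ge 3$ and let the circles $C_\infty$ and $C_j$ ($j\in\mathbb{Z}/n\mathbb{Z}$) in an $n$-flower in the Euclidean plane have curvatures $\kappa_\infty$ and $\kappa_j$ respectively, where $C_\infty$ is the central circle and the $C_j$ are the petal circles. Define $$m_0=\sqrt{\frac{\kappa_0}{\kappa_\infty}+1},\qquad m_j=\sqrt{\left(\frac{\kappa_j}{\kappa_\infty}+1\right)\left(\frac{\kappa_{j-1}}{\kappa_\infty}+1\right)-1}\quad (1\le j\le n-1),$$ where, all curvatures being positive, each quantity under a root is positive and the positive square root is taken, and let $i$ denote the usual square root of $-1$. Then for odd $n$, $$\frac{m_0^2\, i}{2}\left(\prod_{j=1}^{n-1}(m_j-i)-\prod_{j=1}^{n-1}(m_j+i)\right)-\prod_{j=1}^{\frac{n-1}{2}}\left(m_{2j-1}^2+1\right)=0,$$ and for even $n$, $$\frac{i}{2}\left(\prod_{j=1}^{n-1}(m_j-i)-\prod_{j=1}^{n-1}(m_j+i)\right)-\prod_{j=1}^{\frac{n-2}{2}}\left(m_{2j}^2+1\right)=0.$$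
   Context: The curvature of a circle of radius $r>0$ in the Euclidean plane is $1/r$. For $n\ge 3$, an $n$-flower consists of a central circle $C_\infty$, and $n$ petal circles $C_j$, over integers $j$ mod $n$, so that the $C_j$ are externally tangent to $C_\infty$ in order around $C_\infty$, and each $C_j$ is externally tangent to $C_{j-1}$ and $C_{j+1}$. *)

theory Defs
  imports "HOL-Analysis.Analysis"
begin

text \<open>The Euclidean plane is the type \<^typ>\<open>complex\<close>. The datatype does not force radii to be
  positive; positivity is part of the definition of a flower.\<close>

datatype circle = Circle (center: complex) (radius: real)

definition curvature :: "circle \<Rightarrow> real" where
  "curvature C = 1 / radius C"

definition circle_points :: "circle \<Rightarrow> complex set" where
  "circle_points C = sphere (center C) (radius C)"

definition externally_tangent :: "circle \<Rightarrow> circle \<Rightarrow> bool" where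
  "externally_tangent C D \<longleftrightarrow> dist (center C) (center D) = radius C + radius D"

text \<open>The points of \<open>C_inf\<close> at the angles \<open>s * \<theta> j\<close> lie on the petals, hence are the points of
  tangency. They go exactly once around \<open>C_inf\<close> as \<open>j\<close> runs through a period, counterclockwise if
  \<open>s = 1\<close> and clockwise if \<open>s = -1\<close>. That each step is less than \<open>\<pi>\<close> means that two consecutive
  petals touch on the side of the arc leading from one to the next, so that the chain of petals
  really surrounds \<open>C_inf\<close>. Without this bound the definition would admit chains that lie in the gap
  between \<open>C_inf\<close> and two tangent petals, such as three mutually tangent petals where one lies in
  the triangular interstice of \<open>C_inf\<close> and the other two.\<close>

definition in_order_around :: "nat \<Rightarrow> circle \<Rightarrow> (int \<Rightarrow> circle) \<Rightarrow> bool" where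
  "in_order_around n C_inf C \<longleftrightarrow>
     (\<exists>s \<in> {1, -1 :: real}. \<exists>\<theta> :: int \<Rightarrow> real.
        (\<forall>j. center C_inf + of_real (radius C_inf) * cis (s * \<theta> j) \<in> circle_points (C j)) \<and>
        (\<forall>j. \<theta> j < \<theta> (j + 1) \<and> \<theta> (j + 1) < \<theta> j + pi) \<and>
        (\<forall>j. \<theta> (j + int n) = \<theta> j + 2 * pi))"

text \<open>Petals indexed by integers mod \<open>n\<close> are \<open>n\<close>-periodic families indexed by \<^typ>\<open>int\<close>.\<close>

definition flower :: "nat \<Rightarrow> circle \<Rightarrow> (int \<Rightarrow> circle) \<Rightarrow> bool" where
  "flower n C_inf C \<longleftrightarrow>
     n \<ge> 3 \<and>
     radius C_inf > 0 \<and> (\<forall>j. radius (C j) > 0) \<and>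
     (\<forall>j. C (j + int n) = C j) \<and>
     (\<forall>j. externally_tangent (C j) C_inf) \<and>
     (\<forall>j. externally_tangent (C j) (C (j - 1)) \<and> externally_tangent (C j) (C (j + 1))) \<and>
     in_order_around n C_inf C"

end

theory Submission imports Defs
begin

text \<open>Let \<open>2 * \<alpha> j\<close> be the angle at which two consecutive petals are seen from the centre of the
  flower, and let \<open>u j = \<kappa> j / \<kappa>_inf + 1\<close>. The law of cosines in the triangle of centres gives
  \<open>sin (\<alpha> j)\<^sup>2 * u j * u (j - 1) = 1\<close>, hence \<open>m j = cot (\<alpha> j)\<close> and
  \<open>m j + \<i> = sqrt (u j * u (j - 1)) * cis (\<alpha> j)\<close>. The products over \<open>1 \<le> j \<le> n - 1\<close> therefore
  have argument \<open>\<plusminus>(\<pi> - \<alpha> n)\<close>, because the \<open>\<alpha> j\<close> add up to \<open>\<pi>\<close>, and their difference is a multiple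
  of \<open>sin (\<alpha> n) = 1 / sqrt (u 0 * u (n - 1))\<close>. Both sides of the claimed identities reduce to
  products of consecutive \<open>u j\<close>.\<close>

lemma prod_int_Suc:
  fixes f :: "int \<Rightarrow> 'a::comm_monoid_mult"
  shows "(\<Prod>j = 1..1 + int k. f j) = (\<Prod>j = 1..int k. f j) * f (1 + int k)"
proof -
  have "{1..1 + int k} = insert (1 + int k) {1..int k}" by auto
  then show ?thesis by (simp add: mult.commute)
qed

text \<open>With \<open>u\<close> for \<open>f\<close>, the pairs on the right become the factors
  \<open>(m (2 * j))\<^sup>2 + 1\<close> of the even case.\<close>

lemma prod_pairs_even:
  fixes f :: "int \<Rightarrow> 'a::comm_monoid_mult"
  shows "(\<Prod>j = 1..int (2 * k). f j) = (\<Prod>j = 1..int k. f (2 * j) * f (2 * j - 1))"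
proof (induction k)
  case (Suc k)
  have "(\<Prod>j = 1..int (2 * Suc k). f j) = (\<Prod>j = 1..int (2 * k). f j) * f (1 + int (2 * k)) * f (2 + int (2 * k))"
    using prod_int_Suc[of f "Suc (2 * k)"] prod_int_Suc[of f "2 * k"] by simp
  also have "\<dots> = (\<Prod>j = 1..int (Suc k). f (2 * j) * f (2 * j - 1))"
    using prod_int_Suc[of "\<lambda>j. f (2 * j) * f (2 * j - 1)" k]
    by (simp only: Suc.IH) (simp add: algebra_simps)
  finally show ?case .
qed simp

text \<open>The factors \<open>(m (2 * j - 1))\<^sup>2 + 1\<close> of the odd case pair each odd
  index with the one below it, so the pairing starts at index 0. The extra factor \<open>f 0\<close>
  is what \<open>(m 0)\<^sup>2\<close> supplies in the odd identity.\<close>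

lemma prod_pairs_odd:
  fixes f :: "int \<Rightarrow> 'a::comm_monoid_mult"
  shows "f 0 * (\<Prod>j = 1..int (2 * k + 1). f j) =
    (\<Prod>j = 1..int (Suc k). f (2 * j - 1) * f (2 * j - 2))"
proof (induction k)
  case (Suc k)
  have "f 0 * (\<Prod>j = 1..int (2 * Suc k + 1). f j) =
      (f 0 * (\<Prod>j = 1..int (2 * k + 1). f j)) * f (2 + int (2 * k)) * f (3 + int (2 * k))"
    using prod_int_Suc[of f "Suc (Suc (2 * k))"] prod_int_Suc[of f "Suc (2 * k)"]
    by (simp add: ac_simps)
  also have "\<dots> = (\<Prod>j = 1..int (Suc (Suc k)). f (2 * j - 1) * f (2 * j - 2))"
    using prod_int_Suc[of "\<lambda>j. f (2 * j - 1) * f (2 * j - 2)" "Suc k"]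
    by (simp only: Suc.IH) (simp add: algebra_simps)
  finally show ?case .
qed (simp add: mult.commute)

text \<open>Equality case of the triangle inequality: the vectors from the centre of
  \<open>D\<close> to the common point and from there to the centre of \<open>C\<close> have lengths
  adding up to the distance of the centres, so they point in the same direction.\<close>

lemma externally_tangent_center:
  assumes tangent: "externally_tangent C D"
    and r: "radius C > 0" and R: "radius D > 0"
    and p: "center D + of_real (radius D) * cis t \<in> circle_points C"
  shows "center C = center D + of_real (radius D + radius C) * cis t"
proof -
  define x where "x = of_real (radius D) * cis t"
  define y where "y = center C - center D - x"
  have nx: "norm x = radius D" using R by (simp add: x_def norm_mult)
  have ny: "norm y = radius C"
    using p by (simp add: x_def y_def circle_points_def dist_norm algebra_simps)
  have "norm (x + y) = norm x + norm y"
    using tangent nx ny by (simp add: externally_tangent_def dist_norm y_def)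
  then have "radius D *\<^sub>R y = radius C *\<^sub>R x"
    using norm_triangle_eq[of x y] nx ny by simp
  then have "of_real (radius D) * y = of_real (radius D) * (of_real (radius C) * cis t)"
    by (simp add: scaleR_conv_of_real x_def mult_ac)
  then have "y = of_real (radius C) * cis t" using R by simp
  then show ?thesis by (simp add: y_def x_def algebra_simps)
qed

lemma dist_polar_squared:
  "(dist (z + of_real a * cis s) (z + of_real b * cis t))\<^sup>2 =
    a\<^sup>2 + b\<^sup>2 - 2 * a * b * cos (s - t)"
proof -
  have "(dist (z + of_real a * cis s) (z + of_real b * cis t))\<^sup>2 =
      (a * cos s - b * cos t)\<^sup>2 + (a * sin s - b * sin t)\<^sup>2"
    by (simp add: dist_norm cmod_power2)
  also have "\<dots> = a\<^sup>2 * ((cos s)\<^sup>2 + (sin s)\<^sup>2) + b\<^sup>2 * ((cos t)\<^sup>2 + (sin t)\<^sup>2)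
      - 2 * a * b * (cos s * cos t + sin s * sin t)"
    by algebra
  finally show ?thesis by (simp add: cos_diff)
qed

text \<open>Substituting \<open>cos (2 * \<alpha>) = 1 - 2 * (sin \<alpha>)\<^sup>2\<close> turns
  the law of cosines into \<open>(a - b)\<^sup>2 + 4 * (R + a) * (R + b) * (sin \<alpha>)\<^sup>2 =
  (a + b)\<^sup>2\<close>. The quotients \<open>R / a\<close> and \<open>R / b\<close> are the
  curvature ratios.\<close>

lemma tangent_petals_half_angle:
  fixes R a b :: real
  assumes pos: "R > 0" "a > 0" "b > 0"
    and cosines: "(R + a)\<^sup>2 + (R + b)\<^sup>2 - 2 * (R + a) * (R + b) * cos (2 * \<alpha>) = (a + b)\<^sup>2"
  shows "(sin \<alpha>)\<^sup>2 * ((R / a + 1) * (R / b + 1)) = 1"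
proof -
  have "(sin \<alpha>)\<^sup>2 * ((R + a) * (R + b)) = a * b"
    using cosines unfolding cos_double_sin by (simp add: power2_eq_square algebra_simps)
  moreover have "(R / a + 1) * (R / b + 1) = ((R + a) * (R + b)) / (a * b)"
    using pos by (simp add: field_simps)
  ultimately show ?thesis using pos by simp
qed

text \<open>Collects the angular information about the flower. The bound \<open>pi / 2\<close> comes
  from the steps below \<open>pi\<close> in \<open>in_order_around\<close>; it will make the cosines
  positive.\<close>

lemma flower_half_angles:
  assumes "flower n C_inf C"
  obtains \<alpha> :: "int \<Rightarrow> real" and \<theta> :: "int \<Rightarrow> real"
  where "\<And>j. \<alpha> j = (\<theta> j - \<theta> (j - 1)) / 2" "\<And>j. 0 < \<alpha> j" "\<And>j. \<alpha> j < pi / 2"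
    "\<And>j. \<theta> (j + int n) = \<theta> j + 2 * pi"
    "\<And>j. (sin (\<alpha> j))\<^sup>2 * ((curvature (C j) / curvature C_inf + 1) *
       (curvature (C (j - 1)) / curvature C_inf + 1)) = 1"
proof -
  define R where "R = radius C_inf"
  define r where "r j = radius (C j)" for j
  have R: "R > 0" and r: "r j > 0" for j
    using assms by (auto simp: flower_def R_def r_def)
  obtain s \<theta> where s: "s = 1 \<or> s = (-1::real)"
    and points: "\<And>j. center C_inf + of_real R * cis (s * \<theta> j) \<in> circle_points (C j)"
    and step: "\<And>j. \<theta> j < \<theta> (j + 1)" "\<And>j. \<theta> (j + 1) < \<theta> j + pi"
    and period: "\<And>j. \<theta> (j + int n) = \<theta> j + 2 * pi"
  proof -
    have "in_order_around n C_inf C" using assms by (simp add: flower_def)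
    then show thesis using that unfolding in_order_around_def R_def by blast
  qed
  define \<alpha> where "\<alpha> j = (\<theta> j - \<theta> (j - 1)) / 2" for j
  have center: "center (C j) = center C_inf + of_real (R + r j) * cis (s * \<theta> j)" for j
    using externally_tangent_center[of "C j" C_inf "s * \<theta> j"] assms points[of j]
    by (simp add: flower_def R_def r_def)
  have half: "(sin (\<alpha> j))\<^sup>2 * ((R / r j + 1) * (R / r (j - 1) + 1)) = 1" for j
  proof (rule tangent_petals_half_angle[OF R r r])
    have "dist (center (C j)) (center (C (j - 1))) = r j + r (j - 1)"
      using assms by (simp add: flower_def externally_tangent_def r_def)
    \<comment> \<open>The orientation \<open>s\<close> drops out because the cosine is even.\<close>
    moreover have "cos (s * \<theta> j - s * \<theta> (j - 1)) = cos (2 * \<alpha> j)"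
      using s cos_minus[of "\<theta> j - \<theta> (j - 1)"]
      by (auto simp del: cos_minus simp: \<alpha>_def right_diff_distrib diff_divide_distrib)
    ultimately show "(R + r j)\<^sup>2 + (R + r (j - 1))\<^sup>2
        - 2 * (R + r j) * (R + r (j - 1)) * cos (2 * \<alpha> j) = (r j + r (j - 1))\<^sup>2"
      using dist_polar_squared[of "center C_inf" "R + r j" "s * \<theta> j" "R + r (j - 1)" "s * \<theta> (j - 1)"]
      by (simp only: center)
  qed
  show thesis
  proof (rule that[of \<alpha> \<theta>])
    show "0 < \<alpha> j" "\<alpha> j < pi / 2" for j
      using step[of "j - 1"] by (simp_all add: \<alpha>_def)
    show "(sin (\<alpha> j))\<^sup>2 * ((curvature (C j) / curvature C_inf + 1) *
       (curvature (C (j - 1)) / curvature C_inf + 1)) = 1" for j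
      using half[of j] by (simp add: curvature_def R_def r_def)
  qed (simp_all add: \<alpha>_def period)
qed

text \<open>The arguments telescope. In the modulus each interior \<open>w j\<close> comes from two
  neighbouring factors, while \<open>w 0\<close> and \<open>w (1 + int k)\<close> occur only
  once.\<close>

lemma prod_consecutive_cis:
  fixes w \<theta> :: "int \<Rightarrow> real"
  shows "(\<Prod>j = 1..1 + int k. of_real (w j * w (j - 1)) * cis (\<theta> j - \<theta> (j - 1))) =
    of_real (w 0 * w (1 + int k) * (\<Prod>j = 1..int k. (w j)\<^sup>2)) * cis (\<theta> (1 + int k) - \<theta> 0)"
proof (induction k)
  case (Suc k)
  have "cis (\<theta> (1 + int (Suc k)) - \<theta> 0) =
      cis (\<theta> (1 + int k) - \<theta> 0) * cis (\<theta> (1 + int (Suc k)) - \<theta> (1 + int k))"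
    by (simp add: cis_mult)
  then show ?case
    using prod_int_Suc[of "\<lambda>j. of_real (w j * w (j - 1)) * cis (\<theta> j - \<theta> (j - 1))" "Suc k"]
      prod_int_Suc[of "\<lambda>j. (w j)\<^sup>2" k] Suc.IH
    by (simp add: power2_eq_square algebra_simps)
qed simp

text \<open>Since \<open>m\<close> is real, the two products are complex conjugates, and the left
  side is the imaginary part of the second one.\<close>

lemma prod_diff_consecutive:
  fixes w \<theta> m :: "int \<Rightarrow> real"
  assumes m: "\<And>j. 1 \<le> j \<Longrightarrow> j \<le> 1 + int k \<Longrightarrow>
      Complex (m j) 1 = of_real (w j * w (j - 1)) * cis (\<theta> j - \<theta> (j - 1))"
  shows "\<i> / 2 * ((\<Prod>j = 1..1 + int k. (of_real (m j) - \<i>)) - (\<Prod>j = 1..1 + int k. (of_real (m j) + \<i>))) =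
    of_real (w 0 * w (1 + int k) * sin (\<theta> (1 + int k) - \<theta> 0) * (\<Prod>j = 1..int k. (w j)\<^sup>2))"
proof -
  define P where "P = (\<Prod>j = 1..1 + int k. (of_real (m j) + \<i>))"
  have "P = (\<Prod>j = 1..1 + int k. of_real (w j * w (j - 1)) * cis (\<theta> j - \<theta> (j - 1)))"
    unfolding P_def by (rule prod.cong) (use m in \<open>auto simp: complex_eq_iff\<close>)
  then have P: "P = of_real (w 0 * w (1 + int k) * (\<Prod>j = 1..int k. (w j)\<^sup>2)) * cis (\<theta> (1 + int k) - \<theta> 0)"
    by (simp only: prod_consecutive_cis)
  have "(\<Prod>j = 1..1 + int k. (of_real (m j) - \<i>)) = cnj P"
    by (simp add: P_def)
  moreover have "\<i> / 2 * (cnj P - P) = of_real (Im P)"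
    by (simp add: complex_eq_iff)
  moreover have "Im P = w 0 * w (1 + int k) * sin (\<theta> (1 + int k) - \<theta> 0) * (\<Prod>j = 1..int k. (w j)\<^sup>2)"
    unfolding P Re_complex_of_real Im_complex_of_real times_complex.sel cis.sel by simp
  ultimately show ?thesis
    unfolding P_def[symmetric] by simp
qed

theorem mainTheorem1:
  fixes n :: nat and C_inf :: circle and C :: "int \<Rightarrow> circle"
    and \<kappa>_inf :: real and \<kappa> m :: "int \<Rightarrow> real"
  assumes "n \<ge> 3"
    and "flower n C_inf C"
    and "\<kappa>_inf = curvature C_inf"
    and "\<And>j. \<kappa> j = curvature (C j)"
    and "m 0 = sqrt (\<kappa> 0 / \<kappa>_inf + 1)"
    and "\<And>j. 1 \<le> j \<Longrightarrow> j \<le> int n - 1 \<Longrightarrow>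
           m j = sqrt ((\<kappa> j / \<kappa>_inf + 1) * (\<kappa> (j - 1) / \<kappa>_inf + 1) - 1)"
  shows "(odd n \<longrightarrow>
            of_real ((m 0)\<^sup>2) * \<i> / 2 *
              ((\<Prod>j = 1..int n - 1. (of_real (m j) - \<i>)) - (\<Prod>j = 1..int n - 1. (of_real (m j) + \<i>)))
            - (\<Prod>j = 1..(int n - 1) div 2. of_real ((m (2 * j - 1))\<^sup>2 + 1)) = (0 :: complex))
       \<and> (even n \<longrightarrow>
            \<i> / 2 *
              ((\<Prod>j = 1..int n - 1. (of_real (m j) - \<i>)) - (\<Prod>j = 1..int n - 1. (of_real (m j) + \<i>)))
            - (\<Prod>j = 1..(int n - 2) div 2. of_real ((m (2 * j))\<^sup>2 + 1)) = (0 :: complex))"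
proof -
  define u where "u j = \<kappa> j / \<kappa>_inf + 1" for j
  define w where "w j = sqrt (u j)" for j
  obtain \<alpha> \<theta> where \<alpha>: "\<And>j. \<alpha> j = (\<theta> j - \<theta> (j - 1)) / 2" and
    \<alpha>_bounds: "\<And>j. 0 < \<alpha> j" "\<And>j. \<alpha> j < pi / 2" and
    period: "\<And>j. \<theta> (j + int n) = \<theta> j + 2 * pi" and
    sin_sq: "\<And>j. (sin (\<alpha> j))\<^sup>2 * (u j * u (j - 1)) = 1"
    using flower_half_angles[OF assms(2)] unfolding u_def assms(3,4) by metis
  have u_pos: "u j > 0" for j
    using assms(2) by (simp add: u_def assms(3,4) curvature_def flower_def add_pos_pos)
  have w_sq: "(w j)\<^sup>2 = u j" and w_pos: "w j > 0" for j
    using u_pos[of j] by (simp_all add: w_def)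
  have sin_pos: "sin (\<alpha> j) > 0" and cos_pos: "cos (\<alpha> j) > 0" for j
    using \<alpha>_bounds[of j] by (auto intro!: sin_gt_zero cos_gt_zero)
  have sin_w: "w j * w (j - 1) * sin (\<alpha> j) = 1" for j
  proof -
    have "(w j * w (j - 1) * sin (\<alpha> j))\<^sup>2 = 1"
      using sin_sq[of j] by (simp add: power_mult_distrib w_sq mult_ac)
    moreover have "w j * w (j - 1) * sin (\<alpha> j) > 0"
      using w_pos sin_pos by simp
    ultimately show ?thesis by (simp add: power2_eq_1_iff)
  qed
  \<comment> \<open>Positivity of the cosine selects the nonnegative root. With \<open>sin_w\<close>
    this yields the polar form of \<open>m j + \<i>\<close>.\<close>
  have cos_w: "sqrt (u j * u (j - 1) - 1) = w j * w (j - 1) * cos (\<alpha> j)" for j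
  proof (rule real_sqrt_unique)
    have "(w j * w (j - 1) * cos (\<alpha> j))\<^sup>2 = u j * u (j - 1) * (1 - (sin (\<alpha> j))\<^sup>2)"
      by (simp add: power_mult_distrib w_sq cos_squared_eq)
    then show "(w j * w (j - 1) * cos (\<alpha> j))\<^sup>2 = u j * u (j - 1) - 1"
      using sin_sq[of j] by (simp add: algebra_simps)
    show "0 \<le> w j * w (j - 1) * cos (\<alpha> j)"
      using w_pos cos_pos by (simp add: less_imp_le)
  qed
  have m: "m j = w j * w (j - 1) * cos (\<alpha> j)" and m_sq: "(m j)\<^sup>2 + 1 = u j * u (j - 1)"
    if "1 \<le> j" "j \<le> int n - 1" for j
  proof -
    show *: "m j = w j * w (j - 1) * cos (\<alpha> j)"
      using assms(6)[OF that] cos_w[of j] by (simp add: u_def)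
    have "(m j)\<^sup>2 = u j * u (j - 1) * (1 - (sin (\<alpha> j))\<^sup>2)"
      by (simp add: * power_mult_distrib w_sq cos_squared_eq)
    then show "(m j)\<^sup>2 + 1 = u j * u (j - 1)"
      using sin_sq[of j] by (simp add: algebra_simps)
  qed
  have m0_sq: "(m 0)\<^sup>2 = u 0"
    using u_pos[of 0] assms(5) by (simp add: u_def)

  \<comment> \<open>The telescoped product has endpoints 0 and n - 1; \<open>k\<close> counts the
    indices strictly between them.\<close>
  define k where "k = n - 2"
  have k: "n = k + 2" using \<open>n \<ge> 3\<close> by (simp add: k_def)
  have n1: "int n - 1 = 1 + int k" by (simp add: k)
  have "u (int n) = u 0"
    using assms(2) by (metis u_def assms(4) flower_def add.left_neutral)
  then have "w (int n) = w 0" by (simp add: w_def)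
  \<comment> \<open>The half angles of one full turn add up to \<open>pi\<close>; the product stops
    at n - 1, so only the last one is missing.\<close>
  have "(\<theta> (1 + int k) - \<theta> 0) / 2 = pi - \<alpha> (int n)"
    using period[of 0] by (simp add: \<alpha> n1 field_simps)
  then have "sin (\<theta> (1 + int k) / 2 - \<theta> 0 / 2) = sin (\<alpha> (int n))"
    by (simp add: diff_divide_distrib)
  \<comment> \<open>Petal n is petal 0, so its tangency with petal n - 1 makes the endpoint factors
    cancel against the sine.\<close>
  then have closing: "w 0 * w (1 + int k) * sin (\<theta> (1 + int k) / 2 - \<theta> 0 / 2) = 1"
    using sin_w[of "int n"] \<open>w (int n) = w 0\<close> by (simp add: n1)
  \<comment> \<open>The telescoping is applied to \<open>\<theta> j / 2\<close>, whose differences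
    are the half angles.\<close>
  have "Complex (m j) 1 = of_real (w j * w (j - 1)) * cis (\<theta> j / 2 - \<theta> (j - 1) / 2)"
    if "1 \<le> j" "j \<le> 1 + int k" for j
  proof -
    have "\<theta> j / 2 - \<theta> (j - 1) / 2 = \<alpha> j" by (simp add: \<alpha> diff_divide_distrib)
    then show ?thesis
      using m[of j] sin_w[of j] that n1 by (simp add: complex_eq_iff)
  qed
  from prod_diff_consecutive[of k m w "\<lambda>j. \<theta> j / 2", OF this]
  have main: "\<i> / 2 * ((\<Prod>j = 1..int n - 1. (of_real (m j) - \<i>)) - (\<Prod>j = 1..int n - 1. (of_real (m j) + \<i>)))
      = of_real (\<Prod>j = 1..int k. u j)"
    by (simp only: n1 closing w_sq mult_1_left)

  show ?thesis
  proof (intro conjI impI)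
    assume "odd n"
    then obtain l where l: "k = 2 * l + 1" using k by (auto elim: oddE)
    \<comment> \<open>Here n - 1 = 2l + 2, and the l + 1 pairs cover the indices 0 to k.\<close>
    have "(\<Prod>j = 1..(int n - 1) div 2. (m (2 * j - 1))\<^sup>2 + 1)
        = (\<Prod>j = 1..int (Suc l). u (2 * j - 1) * u (2 * j - 2))"
      by (rule prod.cong) (auto simp: k l m_sq)
    also have "\<dots> = (m 0)\<^sup>2 * (\<Prod>j = 1..int k. u j)"
      unfolding l m0_sq prod_pairs_odd ..
    finally have rhs: "(\<Prod>j = 1..(int n - 1) div 2. of_real ((m (2 * j - 1))\<^sup>2 + 1)) =
        of_real ((m 0)\<^sup>2) * (of_real (\<Prod>j = 1..int k. u j) :: complex)"
      unfolding of_real_prod[symmetric] of_real_mult[symmetric] by (rule arg_cong)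
    show "of_real ((m 0)\<^sup>2) * \<i> / 2 *
        ((\<Prod>j = 1..int n - 1. (of_real (m j) - \<i>)) - (\<Prod>j = 1..int n - 1. (of_real (m j) + \<i>)))
      - (\<Prod>j = 1..(int n - 1) div 2. of_real ((m (2 * j - 1))\<^sup>2 + 1)) = (0 :: complex)"
      unfolding rhs main[symmetric] by simp
  next
    assume "even n"
    then obtain l where l: "k = 2 * l" using k by (auto elim: evenE)
    \<comment> \<open>The l pairs cover exactly the indices 1 to k, so no factor \<open>u 0\<close>
      appears.\<close>
    have "(\<Prod>j = 1..(int n - 2) div 2. (m (2 * j))\<^sup>2 + 1)
        = (\<Prod>j = 1..int l. u (2 * j) * u (2 * j - 1))"
      by (rule prod.cong) (auto simp: k l m_sq)
    also have "\<dots> = (\<Prod>j = 1..int k. u j)"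
      unfolding l prod_pairs_even ..
    finally have rhs: "(\<Prod>j = 1..(int n - 2) div 2. of_real ((m (2 * j))\<^sup>2 + 1)) =
        (of_real (\<Prod>j = 1..int k. u j) :: complex)"
      unfolding of_real_prod[symmetric] by (rule arg_cong)
    show "\<i> / 2 *
        ((\<Prod>j = 1..int n - 1. (of_real (m j) - \<i>)) - (\<Prod>j = 1..int n - 1. (of_real (m j) + \<i>)))
      - (\<Prod>j = 1..(int n - 2) div 2. of_real ((m (2 * j))\<^sup>2 + 1)) = (0 :: complex)"
      unfolding rhs main by simp
  qed
qed

end
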